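(* Let $\mathbb{T}$ be a time scale, let $\alpha,\beta\in\mathbb{T}$ with $\alpha<\beta$, and let $\psi,\phi:[\alpha,\beta]_{\mathbb{T}}\to\mathbb{R}$ and $\varphi:\mathbb{R}\times[\alpha,\beta]_{\mathbb{T}}\to(0,\infty)$ be functions with $\phi>0$, such that the derivatives below exist and the Delta integrals below converge for every $s\in\mathbb{R}$. Consider $$P(s)=\frac{\int_\alpha^\beta \psi(\upsilon)\varphi(s,\upsilon)\,\Delta\upsilon}{\int_\alpha^\beta \phi(\upsilon)\varphi(s,\upsilon)\,\Delta\upsilon},\qquad s\in\mathbb{R}.$$ (i) If, for all $s\in\mathbb{R}$ (and all $\upsilon$), either both $$\frac{\partial}{\Delta\upsilon}\Big(\frac{\psi(\upsilon)}{\phi(\upsilon)}\Big)\ge0\quad\text{and}\quad \frac{\partial}{\Delta\upsilon}\Big(\frac{\partial\varphi(s,\upsilon)/\partial s}{\varphi(s,\upsilon)}\Big)\ge0,$$ or both quantities are $\le0$, then $P$ is increasing on $\mathbb{R}$. (ii) If, for all $s\in\mathbb{R}$ (and all $\upsilon$), either $$\frac{\partial}{\Delta\upsilon}\Big(\frac{\psi(\upsilon)}{\phi(\upsilon)}\Big)\ge0\quad\text{and}\quad \frac{\partial}{\Delta\upsilon}\Big(\frac{\partial\varphi(s,\upsilon)/\partial s}{\varphi(s,\upsilon)}\Big)\le0,$$ or the first quantity is $\le0$ and the second is $\ge0$, then $P$ is decreasing on $\mathbb{R}$.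
   Context: A time scale $\mathbb{T}$ is a nonempty closed subset of $\mathbb{R}$, and $[\alpha,\beta]_{\mathbb{T}}=[\alpha,\beta]\cap\mathbb{T}$. The notation $\frac{\partial}{\Delta\upsilon}$ denotes the Delta derivative with respect to $\upsilon\in[\alpha,\beta]_{\mathbb{T}}$: with $\sigma(t)=\inf\{r\in\mathbb{T}:r>t\}$, $f^\Delta(t)$ is the number such that for every $\varepsilon>0$ there is a neighbourhood $U$ of $t$ with $|f(\sigma(t))-f(r)-f^\Delta(t)(\sigma(t)-r)|\le\varepsilon|\sigma(t)-r|$ for all $r\in U\cap\mathbb{T}$ (not considered at the right endpoint $\beta$ if $\beta$ is left-scattered). The Delta integral $\int_a^b f(\upsilon)\,\Delta\upsilon$ is the standard one, i.e. the integral of $f$ over $[a,b)\cap\mathbb{T}$ with respect to the Delta measure $\mu_\Delta$ on $\mathbb{T}$, determined by $\mu_\Delta([c,d)\cap\mathbb{T})=d-c$ for $c\le d$ in $\mathbb{T}$. "Increasing" and "decreasing" are meant in the non-strict sense. In each alternative the sign condition chosen is the same for all $s$ and $\upsilon$. *)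

theory Defs
  imports "HOL-Analysis.Analysis"
begin

definition time_scale :: "real set \<Rightarrow> bool" where
  "time_scale T \<longleftrightarrow> T \<noteq> {} \<and> closed T"

(* A maximal point is its own forward jump and a minimal point its own backward jump;
   this is the usual convention Inf {} = Sup T, Sup {} = Inf T. *)
definition forward_jump :: "real set \<Rightarrow> real \<Rightarrow> real" where
  "forward_jump T t = (if \<exists>r\<in>T. t < r then Inf {r \<in> T. t < r} else t)"

definition backward_jump :: "real set \<Rightarrow> real \<Rightarrow> real" where
  "backward_jump T t = (if \<exists>r\<in>T. r < t then Sup {r \<in> T. r < t} else t)"

(* T without its maximum, if that maximum exists and is left-scattered. *)
definition ts_kappa :: "real set \<Rightarrow> real set" where
  "ts_kappa T = {t \<in> T. \<not> ((\<forall>r\<in>T. r \<le> t) \<and> backward_jump T t < t)}"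

definition has_delta_derivative :: "real set \<Rightarrow> (real \<Rightarrow> real) \<Rightarrow> real \<Rightarrow> real \<Rightarrow> bool" where
  "has_delta_derivative T f D t \<longleftrightarrow>
     (\<forall>e>0. \<exists>U. open U \<and> t \<in> U \<and>
        (\<forall>r \<in> U \<inter> T. \<bar>f (forward_jump T t) - f r - D * (forward_jump T t - r)\<bar>
                       \<le> e * \<bar>forward_jump T t - r\<bar>))"

lemma has_delta_derivative_unique:
  assumes t: "t \<in> ts_kappa T" and T: "T \<noteq> {t}"
    and D: "has_delta_derivative T f D t" "has_delta_derivative T f D' t"
  shows "D = D'"
proof -
  let ?s = "forward_jump T t"
  have tT: "t \<in> T" using t by (simp add: ts_kappa_def)
  have ex: "\<exists>r \<in> U \<inter> T. r \<noteq> ?s" if U: "open U" "t \<in> U" for U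
  proof (rule ccontr)
    assume "\<not> ?thesis"
    then have all: "\<And>r. r \<in> U \<Longrightarrow> r \<in> T \<Longrightarrow> r = ?s" by blast
    have s: "?s = t" using all[OF U(2) tT] by simp
    have no: "\<And>r. r \<in> U \<Longrightarrow> r \<in> T \<Longrightarrow> r = t" using all s by simp
    obtain d where d: "d > 0" "\<And>r. \<bar>r - t\<bar> < d \<Longrightarrow> r \<in> U"
      using U unfolding open_dist dist_real_def by blast
    have far: "\<bar>r - t\<bar> \<ge> d" if "r \<in> T" "r \<noteq> t" for r
      using d(2)[of r] no[of r] that by force
    show False
    proof (cases "\<exists>r\<in>T. t < r")
      case True
      have "t + d \<le> Inf {r \<in> T. t < r}"
        by (rule cInf_greatest) (use True far in force)+
      then show False using s d(1) True by (simp add: forward_jump_def)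
    next
      case False
      then have less: "\<exists>r\<in>T. r < t" using T tT by fastforce
      have "Sup {r \<in> T. r < t} \<le> t - d"
        by (rule cSup_least) (use less far in force)+
      then have "backward_jump T t < t" using less d(1) by (simp add: backward_jump_def)
      then show False using t False by (auto simp: ts_kappa_def not_less)
    qed
  qed
  have "\<bar>D - D'\<bar> \<le> 2 * e" if "e > 0" for e
  proof -
    obtain U V where U: "open U" "t \<in> U" and V: "open V" "t \<in> V"
      and UD: "\<forall>r \<in> U \<inter> T. \<bar>f ?s - f r - D * (?s - r)\<bar> \<le> e * \<bar>?s - r\<bar>"
      and VD: "\<forall>r \<in> V \<inter> T. \<bar>f ?s - f r - D' * (?s - r)\<bar> \<le> e * \<bar>?s - r\<bar>"
      using D \<open>e > 0\<close> unfolding has_delta_derivative_def by meson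
    obtain r where r: "r \<in> U" "r \<in> V" "r \<in> T" "r \<noteq> ?s"
      using ex[of "U \<inter> V"] U V by auto
    have "\<bar>(D - D') * (?s - r)\<bar> \<le> 2 * e * \<bar>?s - r\<bar>"
      using UD[rule_format, of r] VD[rule_format, of r] r by (simp add: left_diff_distrib)
    then show ?thesis using r(4) by (simp add: abs_mult)
  qed
  from this[of "\<bar>D - D'\<bar> / 4"] show ?thesis by (cases "D = D'") auto
qed

definition delta_differentiable :: "real set \<Rightarrow> (real \<Rightarrow> real) \<Rightarrow> real \<Rightarrow> bool" where
  "delta_differentiable T f t \<longleftrightarrow> (\<exists>D. has_delta_derivative T f D t)"

definition delta_deriv :: "real set \<Rightarrow> (real \<Rightarrow> real) \<Rightarrow> real \<Rightarrow> real" where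
  "delta_deriv T f t = (THE D. has_delta_derivative T f D t)"

(* The half-open intervals of T with endpoints in T do not fix the mass of {Max T} when T
   has a maximum; that point never belongs to the domain {a..<b} \<inter> T of a Delta integral. *)
definition delta_measure :: "real set \<Rightarrow> real measure" where
  "delta_measure T =
     extend_measure T {(c, d). c \<in> T \<and> d \<in> T \<and> c \<le> d}
       (\<lambda>(c, d). {c..<d} \<inter> T) (\<lambda>(c, d). ennreal (d - c))"

(* Integrability and integral over {a..<b} \<inter> T for a \<le> b, with respect to the complete
   (Lebesgue) Delta measure. *)
definition delta_integrable :: "real set \<Rightarrow> real \<Rightarrow> real \<Rightarrow> (real \<Rightarrow> real) \<Rightarrow> bool" where
  "delta_integrable T a b f \<longleftrightarrow>
     set_integrable (completion (delta_measure T)) ({a..<b} \<inter> T) f"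

definition delta_integral :: "real set \<Rightarrow> real \<Rightarrow> real \<Rightarrow> (real \<Rightarrow> real) \<Rightarrow> real" where
  "delta_integral T a b f =
     set_lebesgue_integral (completion (delta_measure T)) ({a..<b} \<inter> T) f"

lemma sets_delta_measure:
  "sets (delta_measure T) =
     sigma_sets T ((\<lambda>(c, d). {c..<d} \<inter> T) ` {(c, d). c \<in> T \<and> d \<in> T \<and> c \<le> d})"
  unfolding delta_measure_def by (rule sets_extend_measure) auto

lemma space_delta_measure: "space (delta_measure T) = T"
  unfolding delta_measure_def by (rule space_extend_measure) auto

(* The extension exists: it is the image of Lebesgue measure under x \<mapsto> Max {t \<in> T. t \<le> x}. *)
lemma emeasure_delta_measure:
  assumes T: "time_scale T" and cd: "c \<in> T" "d \<in> T" "c \<le> d"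
  shows "emeasure (delta_measure T) ({c..<d} \<inter> T) = ennreal (d - c)"
proof -
  define X where "X = {x::real. \<exists>t\<in>T. t \<le> x}"
  define g where "g = (\<lambda>x. Sup {t \<in> T. t \<le> x})"
  define G where "G = (\<lambda>(c, d). {c..<d} \<inter> T) ` {(c, d). c \<in> T \<and> d \<in> T \<and> c \<le> d}"
  have closed: "closed T" using T by (simp add: time_scale_def)
  have g: "g x \<in> T" "g x \<le> x" "\<And>t. t \<in> T \<Longrightarrow> t \<le> x \<Longrightarrow> t \<le> g x" if "x \<in> X" for x
  proof -
    have ne: "{t \<in> T. t \<le> x} \<noteq> {}" using that by (auto simp: X_def)
    have bdd: "bdd_above {t \<in> T. t \<le> x}" by (auto simp: bdd_above_def)
    have cl: "closed {t \<in> T. t \<le> x}"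
      using closed_Int[OF closed closed_atMost[of x]] by (simp add: Int_def)
    have "g x \<in> {t \<in> T. t \<le> x}"
      unfolding g_def by (rule closed_contains_Sup[OF ne bdd cl])
    then show "g x \<in> T" "g x \<le> x" by auto
    show "t \<le> g x" if "t \<in> T" "t \<le> x" for t
      unfolding g_def by (rule cSup_upper) (use that bdd in auto)
  qed
  have pre: "g -` ({c..<d} \<inter> T) \<inter> X = {c..<d}" if "c \<in> T" "d \<in> T" for c d
  proof (intro set_eqI iffI)
    fix x assume "x \<in> g -` ({c..<d} \<inter> T) \<inter> X"
    then have x: "x \<in> X" "c \<le> g x" "g x < d" by auto
    have "x < d"
    proof (rule ccontr)
      assume "\<not> x < d"
      then have "d \<le> g x" using g(3)[OF x(1) that(2)] by simp
      then show False using x(3) by simp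
    qed
    then show "x \<in> {c..<d}" using g(2)[OF x(1)] x(2) by auto
  next
    fix x assume x: "x \<in> {c..<d}"
    then have "x \<in> X" using that by (auto simp: X_def)
    then show "x \<in> g -` ({c..<d} \<inter> T) \<inter> X"
      using g[of x] x that by fastforce
  qed
  have X: "X \<in> sets borel"
  proof -
    have "is_interval X"
      unfolding is_interval_1 X_def by (auto intro: order_trans)
    then show ?thesis by (rule real_interval_borel_measurable)
  qed
  define M where "M = distr (restrict_space lborel X) (sigma T G) g"
  have GT: "G \<subseteq> Pow T" by (auto simp: G_def)
  have meas: "g \<in> measurable (restrict_space lborel X) (sigma T G)"
  proof (rule measurable_measure_of[OF GT])
    show "g \<in> space (restrict_space lborel X) \<rightarrow> T"
      using g(1) by (auto simp: space_restrict_space)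
    fix A assume "A \<in> G"
    then obtain c d where "c \<in> T" "d \<in> T" "A = {c..<d} \<inter> T" by (auto simp: G_def)
    then have "g -` A \<inter> X = {c..<d}" using pre by simp
    then show "g -` A \<inter> space (restrict_space lborel X) \<in> sets (restrict_space lborel X)"
      using X by (auto simp: space_restrict_space sets_restrict_space_iff)
  qed
  have setsM: "sets (delta_measure T) = sets M"
    using GT by (simp add: sets_delta_measure M_def G_def)
  show ?thesis
  proof (rule emeasure_extend_measure_Pair[where \<mu>' = "emeasure M" and I = "\<lambda>c d. c \<in> T \<and> d \<in> T \<and> c \<le> d"
        and G = "\<lambda>c d. {c..<d} \<inter> T" and \<mu> = "\<lambda>c d. ennreal (d - c)", OF delta_measure_def])
    fix a b assume ab: "a \<in> T \<and> b \<in> T \<and> a \<le> b"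
    then have "{a..<b} \<inter> T \<in> sets (sigma T G)" using GT by (auto simp: G_def)
    then have "emeasure M ({a..<b} \<inter> T) =
        emeasure (restrict_space lborel X) (g -` ({a..<b} \<inter> T) \<inter> X)"
      by (simp add: M_def emeasure_distr[OF meas] space_restrict_space del: vimage_Int)
    also have "\<dots> = emeasure (restrict_space lborel X) {a..<b}"
      using ab pre[of a b] by simp
    also have "\<dots> = emeasure lborel {a..<b}"
      using X ab by (subst emeasure_restrict_space) (auto simp: X_def intro: order_trans)
    finally show "emeasure M ({a..<b} \<inter> T) = ennreal (b - a)" using ab by simp
  next
    show "positive (sets (delta_measure T)) (emeasure M)" by (simp add: positive_def)
    show "countably_additive (sets (delta_measure T)) (emeasure M)"
      unfolding setsM by (rule emeasure_countably_additive)
  qed (use cd in auto)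
qed

end

(* A function whose Delta derivative has constant sign is monotone. Applied to the logarithmic
   s-derivative of varphi, and then integrated in s, this makes varphi s2 / varphi s1 monotone
   in the time variable for s1 <= s2. Since psi / phi is monotone too, the comparison of P s1
   with P s2 is Chebyshev's integral inequality for the weight phi * varphi s1. *)
theory Submission
  imports Defs
begin

section \<open>From the sign of the Delta derivative to monotonicity on a closed set\<close>

lemma has_delta_derivative_minus:
  assumes "has_delta_derivative K f D t"
  shows "has_delta_derivative K (\<lambda>x. - f x) (- D) t"
proof -
  have "\<bar>- f u - - f r - - D * (u - r)\<bar> = \<bar>f u - f r - D * (u - r)\<bar>" for u r
    using abs_minus_cancel[of "f u - f r - D * (u - r)"] by (simp add: algebra_simps)
  then show ?thesis
    using assms unfolding has_delta_derivative_def by simp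
qed

text \<open>Uniqueness makes the description in \<open>delta_deriv\<close> denote the derivative. A
  singleton has to be excluded, since there every number satisfies the definition of a Delta
  derivative.\<close>

lemma has_delta_derivative_delta_deriv:
  assumes "t \<in> ts_kappa K" "K \<noteq> {t}" "delta_differentiable K f t"
  shows "has_delta_derivative K f (delta_deriv K f t) t"
proof -
  obtain D where D: "has_delta_derivative K f D t"
    using assms(3) by (auto simp: delta_differentiable_def)
  show ?thesis
    unfolding delta_deriv_def
    by (rule theI[of _ D]) (use D has_delta_derivative_unique[OF assms(1,2)] in blast)+
qed

text \<open>\<open>f r - f t\<close> is the difference of the two error terms at \<open>t\<close>
  and \<open>r\<close> plus \<open>D * (r - t)\<close>. Both errors are measured from the forward
  jump, which may stay away from \<open>t\<close>, so \<open>e\<close> must be chosen small relative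
  to that gap.\<close>

lemma has_delta_derivative_continuous:
  assumes t: "t \<in> K" and D: "has_delta_derivative K f D t"
  shows "continuous (at t within K) f"
  unfolding continuous_within_eps_delta dist_real_def
proof (intro allI impI)
  fix \<eta> :: real assume \<eta>: "\<eta> > 0"
  define u where "u = forward_jump K t"
  \<comment> \<open>The quotient keeps the gap's share \<open>2 * e * \<bar>u - t\<bar>\<close> of
    the errors below \<eta>/2; the bound 1 lets \<open>e * \<bar>r - t\<bar>\<close> be absorbed
    into the factor \<open>\<bar>D\<bar> + 1\<close>.\<close>
  define e where "e = min 1 (\<eta> / (4 * (\<bar>u - t\<bar> + 1)))"
  have e: "e > 0" "e \<le> 1" using \<eta> by (auto simp: e_def intro!: divide_pos_pos add_nonneg_pos)
  have "e * (4 * (\<bar>u - t\<bar> + 1)) \<le> \<eta>"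
    by (subst pos_le_divide_eq[symmetric]) (auto simp: e_def intro: add_nonneg_pos)
  then have eu: "2 * (e * \<bar>u - t\<bar>) < \<eta> / 2"
    using e by (simp add: algebra_simps)
  obtain U where U: "open U" "t \<in> U"
    and UD: "\<And>r. r \<in> U \<Longrightarrow> r \<in> K \<Longrightarrow> \<bar>f u - f r - D * (u - r)\<bar> \<le> e * \<bar>u - r\<bar>"
    using D e(1) unfolding has_delta_derivative_def u_def by (meson IntI)
  obtain d where d: "d > 0" "\<And>r. \<bar>r - t\<bar> < d \<Longrightarrow> r \<in> U"
    using U unfolding open_dist dist_real_def by blast
  have "\<bar>f r - f t\<bar> < \<eta>"
    if r: "r \<in> K" "\<bar>r - t\<bar> < min d (\<eta> / (2 * (\<bar>D\<bar> + 1)))" for r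
  proof -
    have "(\<bar>D\<bar> + 1) * \<bar>r - t\<bar> \<le> (\<bar>D\<bar> + 1) * (\<eta> / (2 * (\<bar>D\<bar> + 1)))"
      by (rule mult_left_mono) (use r in auto)
    also have "\<dots> = \<eta> / 2" by (simp add: field_simps)
    finally have A: "(\<bar>D\<bar> + 1) * \<bar>r - t\<bar> \<le> \<eta> / 2" .
    have "e * \<bar>u - r\<bar> \<le> e * (\<bar>u - t\<bar> + \<bar>r - t\<bar>)"
      by (rule mult_left_mono) (use e in auto)
    also have "\<dots> \<le> e * \<bar>u - t\<bar> + \<bar>r - t\<bar>"
      using e mult_right_mono[of e 1 "\<bar>r - t\<bar>"] by (simp add: distrib_left)
    finally have B: "e * \<bar>u - r\<bar> \<le> e * \<bar>u - t\<bar> + \<bar>r - t\<bar>" .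
    have "f r - f t = (f u - f t - D * (u - t)) - (f u - f r - D * (u - r)) + D * (r - t)"
      by (simp add: algebra_simps)
    moreover have "\<bar>D * (r - t)\<bar> = \<bar>D\<bar> * \<bar>r - t\<bar>" by (rule abs_mult)
    ultimately show ?thesis
      using UD[OF U(2) t] UD[OF d(2)[of r] r(1)] r(2) A B eu
      unfolding distrib_right mult_1 by linarith
  qed
  moreover have "min d (\<eta> / (2 * (\<bar>D\<bar> + 1))) > 0" using d \<eta> by simp
  ultimately show "\<exists>d>0. \<forall>r\<in>K. \<bar>r - t\<bar> < d \<longrightarrow> \<bar>f r - f t\<bar> < \<eta>" by blast
qed

text \<open>Such a point is a left-scattered maximum, so the open ray beyond its backward jump meets
  \<open>K\<close> in it alone. This supplies continuity at the one point where no derivative is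
  assumed.\<close>

lemma not_ts_kappa_isolated:
  assumes "t \<in> K" "t \<notin> ts_kappa K"
  shows "at t within K = bot"
proof -
  have max: "\<And>r. r \<in> K \<Longrightarrow> r \<le> t" and less: "backward_jump K t < t"
    using assms by (auto simp: ts_kappa_def)
  have "bdd_above {r \<in> K. r < t}" by (auto simp: bdd_above_def intro: less_imp_le)
  then have "r \<le> backward_jump K t" if "r \<in> K" "r < t" for r
    using that cSup_upper[of r "{r \<in> K. r < t}"] by (auto simp: backward_jump_def)
  then have "r = t" if "r \<in> K" "r \<in> {backward_jump K t<..}" for r
    using that max[of r] by force
  then have "\<not> t islimpt K"
    unfolding islimpt_def using less by (metis greaterThan_iff open_greaterThan)
  then show ?thesis by (simp add: trivial_limit_within)
qed

text \<open>Tilting \<open>f\<close> by a slope \<open>e > 0\<close> absorbs the error in the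
  definition of the derivative, and \<open>e\<close> is then sent to 0. The hypothesis speaks of
  some \<open>D\<close> rather than of \<open>delta_deriv\<close>, so that it applies directly to
  \<open>- f\<close>.\<close>

lemma delta_derivative_nonneg_imp_mono_on:
  assumes K: "closed K"
    and deriv: "\<And>t. t \<in> ts_kappa K \<Longrightarrow> \<exists>D\<ge>0. has_delta_derivative K f D t"
  shows "mono_on K f"
proof (rule mono_onI)
  have cont: "continuous_on K f"
    unfolding continuous_on_eq_continuous_within
  proof
    fix t assume "t \<in> K"
    then show "continuous (at t within K) f"
      using deriv has_delta_derivative_continuous not_ts_kappa_isolated
      by (metis continuous_bot)
  qed
  fix a b assume ab: "a \<in> K" "b \<in> K" "a \<le> b"
  have "f a \<le> f b + e * (b - a)" if e: "e > 0" for e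
  proof (rule ccontr)
    assume less: "\<not> ?thesis"
    (* At the last point c where f t + e * (t - a) still reaches f a, the derivative yields
       a later such point: the forward jump if c is right-scattered, a nearby point otherwise. *)
    define L where "L = {t \<in> K \<inter> {a..b}. f a \<le> f t + e * (t - a)}"
    have "closed L"
      unfolding L_def
      by (intro continuous_on_closed_Collect_le continuous_intros
          continuous_on_subset[OF cont] closed_Int K) auto
    moreover have "L \<noteq> {}" "bdd_above L"
      using ab e by (auto simp: L_def bdd_above_def)
    ultimately have "Sup L \<in> L" by (intro closed_contains_Sup)
    then obtain c where c: "c \<in> K" "a \<le> c" "c \<le> b" "f a \<le> f c + e * (c - a)"
      and Sup: "\<And>t. t \<in> L \<Longrightarrow> t \<le> c"
      using \<open>bdd_above L\<close> cSup_upper[of _ L] by (auto simp: L_def)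
    \<comment> \<open>At \<open>c = b\<close> the defining inequality of \<open>L\<close> would be
      the one just denied. As \<open>c < b\<close>, the point \<open>c\<close> is not the maximum of
      \<open>K\<close> and has a derivative.\<close>
    have cb: "c < b" using c less by (cases "c = b") auto
    then have "c \<in> ts_kappa K" using c ab by (force simp: ts_kappa_def)
    then obtain D where D: "D \<ge> 0" "has_delta_derivative K f D c" using deriv by blast
    define u where "u = forward_jump K c"
    obtain U where U: "open U" "c \<in> U"
      and UD: "\<And>r. r \<in> U \<Longrightarrow> r \<in> K \<Longrightarrow> \<bar>f u - f r - D * (u - r)\<bar> \<le> e * \<bar>u - r\<bar>"
      using D e unfolding has_delta_derivative_def u_def by (meson IntI)
    let ?R = "{r \<in> K. c < r}"
    have R: "b \<in> ?R" "bdd_below ?R"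
      using ab cb by (auto simp: bdd_below_def intro: less_imp_le)
    have u: "u = Inf ?R" using R by (auto simp: u_def forward_jump_def)
    have ub: "u \<le> b" unfolding u using R by (intro cInf_lower)
    have cu: "c \<le> u" unfolding u using R by (intro cInf_greatest) auto
    have "\<exists>r\<in>K. c < r \<and> r \<le> b \<and> f c \<le> f r + e * (r - c)"
    proof (cases "u = c")
      case False
      have "u \<in> K"
        using closure_contains_Inf[of ?R] R closure_mono[of ?R K] closure_closed[OF K]
        unfolding u by auto
      \<comment> \<open>The derivative inequality is used at \<open>r = c\<close> itself: it bounds
        the jump of \<open>f\<close> from \<open>c\<close> to \<open>u\<close> below by
        \<open>(D - e) * (u - c)\<close>.\<close>
      moreover have "f c \<le> f u + e * (u - c)"
        using UD[OF U(2) c(1)] cu mult_nonneg_nonneg[OF D(1), of "u - c"] by simp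
      ultimately show ?thesis using False cu ub by force
    next
      case True
      obtain d where d: "d > 0" "\<And>r. \<bar>r - c\<bar> < d \<Longrightarrow> r \<in> U"
        using U unfolding open_dist dist_real_def by blast
      \<comment> \<open>Here \<open>c\<close> is right-dense, so points of \<open>K\<close> lie
        arbitrarily close to its right; the minimum keeps the chosen one inside both
        \<open>U\<close> and \<open>{a..b}\<close>.\<close>
      have "Inf ?R < c + min d (b - c)" using True u d cb by simp
      then obtain r where r: "r \<in> K" "c < r" "r < c + min d (b - c)"
        using cInf_lessD[of ?R] R by blast
      then have "\<bar>f c - f r - D * (c - r)\<bar> \<le> e * \<bar>c - r\<bar>"
        using UD[of r] d(2)[of r] True by simp
      then have "f c \<le> f r + e * (r - c)"
        using r(2) mult_nonneg_nonneg[OF D(1), of "r - c"] by (simp add: algebra_simps)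
      then show ?thesis using r by force
    qed
    then obtain r where r: "r \<in> K" "c < r" "r \<le> b" "f c \<le> f r + e * (r - c)" by blast
    then have "r \<in> L" using c by (auto simp: L_def algebra_simps)
    then show False using Sup r by force
  qed
  note step = this
  show "f a \<le> f b"
  proof (rule field_le_epsilon)
    fix \<eta> :: real assume \<eta>: "\<eta> > 0"
    \<comment> \<open>The summand 1 keeps the denominator positive when
      \<open>a = b\<close>.\<close>
    have "\<eta> / (b - a + 1) * (b - a) \<le> \<eta>" using \<eta> ab by (simp add: field_simps)
    moreover have "\<eta> / (b - a + 1) > 0" using \<eta> ab by simp
    ultimately show "f a \<le> f b + \<eta>" using step[of "\<eta> / (b - a + 1)"] by linarith
  qed
qed

lemma delta_deriv_nonneg_imp_mono_on:
  assumes "closed K" "\<And>t. K \<noteq> {t}"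
    and "\<And>t. t \<in> ts_kappa K \<Longrightarrow> delta_differentiable K f t"
    and "\<And>t. t \<in> ts_kappa K \<Longrightarrow> 0 \<le> delta_deriv K f t"
  shows "mono_on K f"
  by (rule delta_derivative_nonneg_imp_mono_on)
    (use assms has_delta_derivative_delta_deriv in blast)+

lemma delta_deriv_nonpos_imp_antimono_on:
  assumes "closed K" "\<And>t. K \<noteq> {t}"
    and "\<And>t. t \<in> ts_kappa K \<Longrightarrow> delta_differentiable K f t"
    and "\<And>t. t \<in> ts_kappa K \<Longrightarrow> delta_deriv K f t \<le> 0"
  shows "antimono_on K f"
proof -
  have "\<exists>D\<ge>0. has_delta_derivative K (\<lambda>x. - f x) D t" if "t \<in> ts_kappa K" for t
    using has_delta_derivative_minus[OF has_delta_derivative_delta_deriv] assms that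
    by (meson neg_0_le_iff_le)
  then have "mono_on K (\<lambda>x. - f x)"
    by (rule delta_derivative_nonneg_imp_mono_on[OF assms(1)])
  then show ?thesis by (auto simp: monotone_on_def)
qed

section \<open>Ratios of functions of s and quotients of integrals\<close>

text \<open>The derivative of \<open>ln q - ln p\<close> is the difference of the logarithmic
  derivatives, so \<open>q / p\<close> is nondecreasing; the conclusion is this fact with
  denominators cleared.\<close>

lemma log_deriv_le_imp_ratio_le:
  fixes p q :: "real \<Rightarrow> real"
  assumes pos: "\<And>s. p s > 0" "\<And>s. q s > 0"
    and diff: "\<And>s. p differentiable (at s)" "\<And>s. q differentiable (at s)"
    and le: "\<And>s. deriv p s / p s \<le> deriv q s / q s"
    and st: "s \<le> t"
  shows "p t * q s \<le> q t * p s"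
proof -
  have D: "(p has_real_derivative deriv p s) (at s)" "(q has_real_derivative deriv q s) (at s)" for s
    using diff by (auto intro: DERIV_deriv_iff_real_differentiable[THEN iffD2])
  have "ln (q s) - ln (p s) \<le> ln (q t) - ln (p t)"
  proof (rule DERIV_nonneg_imp_nondecreasing[OF st])
    fix r
    have "((\<lambda>s. ln (q s) - ln (p s)) has_real_derivative deriv q r / q r - deriv p r / p r) (at r)"
      using pos by (auto intro!: derivative_eq_intros D simp: field_simps)
    then show "\<exists>y. ((\<lambda>s. ln (q s) - ln (p s)) has_real_derivative y) (at r) \<and> 0 \<le> y"
      using le[of r] by auto
  qed
  then have "ln (p t * q s) \<le> ln (q t * p s)"
    using pos by (simp add: ln_mult less_imp_neq[THEN not_sym])
  then show ?thesis using pos by (simp add: ln_le_cancel_iff)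
qed

text \<open>This is the symmetrised form of Chebyshev's inequality. Every term is a product of a
  function of \<open>x\<close> and a function of \<open>y\<close>, so integrating in one variable
  and then in the other uses only linearity and monotonicity; each side becomes twice a product of
  integrals.\<close>

lemma integral_ratio_le:
  fixes a\<^sub>1 a\<^sub>2 b\<^sub>1 b\<^sub>2 :: "'a \<Rightarrow> real"
  assumes int: "set_integrable M S a\<^sub>1" "set_integrable M S a\<^sub>2"
      "set_integrable M S b\<^sub>1" "set_integrable M S b\<^sub>2"
    and pos: "0 < set_lebesgue_integral M S a\<^sub>1" "0 < set_lebesgue_integral M S a\<^sub>2"
    and le: "\<And>x y. x \<in> S \<Longrightarrow> y \<in> S \<Longrightarrow>
      b\<^sub>1 x * a\<^sub>2 y + b\<^sub>1 y * a\<^sub>2 x \<le> b\<^sub>2 x * a\<^sub>1 y + b\<^sub>2 y * a\<^sub>1 x"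
  shows "set_lebesgue_integral M S b\<^sub>1 / set_lebesgue_integral M S a\<^sub>1
       \<le> set_lebesgue_integral M S b\<^sub>2 / set_lebesgue_integral M S a\<^sub>2"
proof -
  let ?I = "set_lebesgue_integral M S"
  note [simp] = set_integral_add set_integral_diff int
  have "?I b\<^sub>1 * a\<^sub>2 y + b\<^sub>1 y * ?I a\<^sub>2 \<le> ?I b\<^sub>2 * a\<^sub>1 y + b\<^sub>2 y * ?I a\<^sub>1" if "y \<in> S" for y
  proof -
    have "?I (\<lambda>x. b\<^sub>1 x * a\<^sub>2 y + b\<^sub>1 y * a\<^sub>2 x) \<le> ?I (\<lambda>x. b\<^sub>2 x * a\<^sub>1 y + b\<^sub>2 y * a\<^sub>1 x)"
      by (rule set_integral_mono) (use le that in auto)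
    then show ?thesis by simp
  qed
  then have "?I (\<lambda>y. ?I b\<^sub>1 * a\<^sub>2 y + b\<^sub>1 y * ?I a\<^sub>2) \<le> ?I (\<lambda>y. ?I b\<^sub>2 * a\<^sub>1 y + b\<^sub>2 y * ?I a\<^sub>1)"
    by (intro set_integral_mono) auto
  then have "?I b\<^sub>1 * ?I a\<^sub>2 \<le> ?I b\<^sub>2 * ?I a\<^sub>1"
    by (simp add: mult.commute)
  then show ?thesis using pos by (simp add: pos_divide_le_eq pos_le_divide_eq)
qed

text \<open>A zero integral would force the positive \<open>f\<close> to vanish almost everywhere on
  the domain, making it a null set, whereas its Delta measure is \<open>b - a > 0\<close>. This
  gives the positive denominators of \<open>P\<close>.\<close>

lemma delta_integral_pos:
  assumes T: "time_scale T" "a \<in> T" "b \<in> T" "a < b"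
    and f: "delta_integrable T a b f" "\<And>x. x \<in> {a..<b} \<inter> T \<Longrightarrow> 0 < f x"
  shows "0 < delta_integral T a b f"
proof -
  let ?M = "completion (delta_measure T)" and ?S = "{a..<b} \<inter> T"
  let ?g = "\<lambda>x. indicator ?S x *\<^sub>R f x"
  have S: "?S \<in> sets (delta_measure T)"
    using T unfolding sets_delta_measure by (intro sigma_sets.Basic image_eqI[where x = "(a, b)"]) auto
  have g: "integrable ?M ?g" "\<And>x. 0 \<le> ?g x"
    using f by (auto simp: delta_integrable_def set_integrable_def indicator_def intro: less_imp_le)
  have "integral\<^sup>L ?M ?g \<noteq> 0"
  proof
    assume "integral\<^sup>L ?M ?g = 0"
    then have "AE x in ?M. ?g x = 0"
      using integral_nonneg_eq_0_iff_AE[OF g(1)] g(2) by simp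
    then have "AE x in ?M. x \<notin> ?S"
      by (rule AE_mp) (use f(2) in \<open>auto simp: indicator_def less_le\<close>)
    then have "emeasure ?M ?S = 0"
      using S by (subst (asm) AE_iff_measurable[of ?S]) (auto simp: space_delta_measure)
    then show False
      using S emeasure_delta_measure[of T a b] T by simp
  qed
  moreover have "0 \<le> integral\<^sup>L ?M ?g" using g by simp
  ultimately show ?thesis by (simp add: delta_integral_def set_lebesgue_integral_def)
qed

theorem theorem3p4:
  fixes T :: "real set" and \<alpha> \<beta> :: real
    and \<psi> \<phi> :: "real \<Rightarrow> real" and varphi :: "real \<Rightarrow> real \<Rightarrow> real"
    and P :: "real \<Rightarrow> real"
  assumes "time_scale T" and "\<alpha> \<in> T" and "\<beta> \<in> T" and "\<alpha> < \<beta>"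
    and "\<And>\<upsilon>. \<upsilon> \<in> {\<alpha>..\<beta>} \<inter> T \<Longrightarrow> \<phi> \<upsilon> > 0"
    and "\<And>s \<upsilon>. \<upsilon> \<in> {\<alpha>..\<beta>} \<inter> T \<Longrightarrow> varphi s \<upsilon> > 0"
    and "\<And>s \<upsilon>. \<upsilon> \<in> {\<alpha>..\<beta>} \<inter> T \<Longrightarrow> (\<lambda>s. varphi s \<upsilon>) differentiable (at s)"
    and "\<And>\<upsilon>. \<upsilon> \<in> ts_kappa ({\<alpha>..\<beta>} \<inter> T) \<Longrightarrow>
           delta_differentiable ({\<alpha>..\<beta>} \<inter> T) (\<lambda>\<upsilon>. \<psi> \<upsilon> / \<phi> \<upsilon>) \<upsilon>"
    and "\<And>s \<upsilon>. \<upsilon> \<in> ts_kappa ({\<alpha>..\<beta>} \<inter> T) \<Longrightarrow>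
           delta_differentiable ({\<alpha>..\<beta>} \<inter> T) (\<lambda>\<upsilon>. deriv (\<lambda>s. varphi s \<upsilon>) s / varphi s \<upsilon>) \<upsilon>"
    and "\<And>s. delta_integrable T \<alpha> \<beta> (\<lambda>\<upsilon>. \<psi> \<upsilon> * varphi s \<upsilon>)"
    and "\<And>s. delta_integrable T \<alpha> \<beta> (\<lambda>\<upsilon>. \<phi> \<upsilon> * varphi s \<upsilon>)"
    and "\<And>s. P s = delta_integral T \<alpha> \<beta> (\<lambda>\<upsilon>. \<psi> \<upsilon> * varphi s \<upsilon>)
                    / delta_integral T \<alpha> \<beta> (\<lambda>\<upsilon>. \<phi> \<upsilon> * varphi s \<upsilon>)"
  shows "((\<forall>s. \<forall>\<upsilon> \<in> ts_kappa ({\<alpha>..\<beta>} \<inter> T).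
              delta_deriv ({\<alpha>..\<beta>} \<inter> T) (\<lambda>\<upsilon>. \<psi> \<upsilon> / \<phi> \<upsilon>) \<upsilon> \<ge> 0 \<and>
              delta_deriv ({\<alpha>..\<beta>} \<inter> T) (\<lambda>\<upsilon>. deriv (\<lambda>s. varphi s \<upsilon>) s / varphi s \<upsilon>) \<upsilon> \<ge> 0)
          \<or> (\<forall>s. \<forall>\<upsilon> \<in> ts_kappa ({\<alpha>..\<beta>} \<inter> T).
              delta_deriv ({\<alpha>..\<beta>} \<inter> T) (\<lambda>\<upsilon>. \<psi> \<upsilon> / \<phi> \<upsilon>) \<upsilon> \<le> 0 \<and>
              delta_deriv ({\<alpha>..\<beta>} \<inter> T) (\<lambda>\<upsilon>. deriv (\<lambda>s. varphi s \<upsilon>) s / varphi s \<upsilon>) \<upsilon> \<le> 0)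
          \<longrightarrow> mono P)
       \<and> ((\<forall>s. \<forall>\<upsilon> \<in> ts_kappa ({\<alpha>..\<beta>} \<inter> T).
              delta_deriv ({\<alpha>..\<beta>} \<inter> T) (\<lambda>\<upsilon>. \<psi> \<upsilon> / \<phi> \<upsilon>) \<upsilon> \<ge> 0 \<and>
              delta_deriv ({\<alpha>..\<beta>} \<inter> T) (\<lambda>\<upsilon>. deriv (\<lambda>s. varphi s \<upsilon>) s / varphi s \<upsilon>) \<upsilon> \<le> 0)
          \<or> (\<forall>s. \<forall>\<upsilon> \<in> ts_kappa ({\<alpha>..\<beta>} \<inter> T).
              delta_deriv ({\<alpha>..\<beta>} \<inter> T) (\<lambda>\<upsilon>. \<psi> \<upsilon> / \<phi> \<upsilon>) \<upsilon> \<le> 0 \<and>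
              delta_deriv ({\<alpha>..\<beta>} \<inter> T) (\<lambda>\<upsilon>. deriv (\<lambda>s. varphi s \<upsilon>) s / varphi s \<upsilon>) \<upsilon> \<ge> 0)
          \<longrightarrow> antimono P)"
proof -
  let ?K = "{\<alpha>..\<beta>} \<inter> T"
  let ?g = "\<lambda>\<upsilon>. \<psi> \<upsilon> / \<phi> \<upsilon>" and ?h = "\<lambda>s \<upsilon>. deriv (\<lambda>s. varphi s \<upsilon>) s / varphi s \<upsilon>"
  note phi = assms(5) and varphi = assms(6) and diff = assms(7)
  have K: "closed ?K" "?K \<noteq> {t}" for t
  proof -
    show "closed ?K" using assms(1) by (auto simp: time_scale_def)
    have "\<alpha> \<in> ?K" "\<beta> \<in> ?K" using assms(2-4) by auto
    then show "?K \<noteq> {t}" using assms(4) by (metis less_irrefl singletonD)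
  qed
  \<comment> \<open>Up to positive factors, the two factors are the increments from \<open>x\<close>
    to \<open>y\<close> of \<psi>/\<phi> and of \<open>varphi t / varphi s\<close>. No order of
    \<open>s\<close> and \<open>t\<close> is imposed, so that the same criterion serves the
    decreasing case.\<close>
  have P_le: "P s \<le> P t"
    if "\<And>x y. x \<in> ?K \<Longrightarrow> y \<in> ?K \<Longrightarrow> x \<le> y \<Longrightarrow>
      0 \<le> (\<psi> y * \<phi> x - \<psi> x * \<phi> y) * (varphi t y * varphi s x - varphi t x * varphi s y)"
    for s t
    unfolding assms(12) delta_integral_def
  proof (rule integral_ratio_le)
    fix x y assume xy: "x \<in> {\<alpha>..<\<beta>} \<inter> T" "y \<in> {\<alpha>..<\<beta>} \<inter> T"
    have "0 \<le> (\<psi> y * \<phi> x - \<psi> x * \<phi> y) * (varphi t y * varphi s x - varphi t x * varphi s y)"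
      \<comment> \<open>Exchanging \<open>x\<close> and \<open>y\<close> changes the sign of both
        factors, so the product is symmetric and the case \<open>x \<le> y\<close> suffices.\<close>
      using that[of x y] that[of y x] xy by (cases x y rule: le_cases) (auto simp: algebra_simps)
    then show "\<psi> x * varphi s x * (\<phi> y * varphi t y) + \<psi> y * varphi s y * (\<phi> x * varphi t x)
        \<le> \<psi> x * varphi t x * (\<phi> y * varphi s y) + \<psi> y * varphi t y * (\<phi> x * varphi s x)"
      by (simp add: algebra_simps)
  qed (use assms(10,11) delta_integral_pos[OF assms(1-4) assms(11)] phi varphi
      in \<open>auto simp: delta_integrable_def delta_integral_def\<close>)
  have g_le: "\<psi> x * \<phi> y \<le> \<psi> y * \<phi> x" if "mono_on ?K ?g" "x \<in> ?K" "y \<in> ?K" "x \<le> y" for x y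
    using mono_onD[OF that] phi[OF that(2)] phi[OF that(3)] by (simp add: field_simps)
  have g_ge: "\<psi> y * \<phi> x \<le> \<psi> x * \<phi> y" if "antimono_on ?K ?g" "x \<in> ?K" "y \<in> ?K" "x \<le> y" for x y
    using monotone_onD[OF that] phi[OF that(2)] phi[OF that(3)] by (simp add: field_simps)
  have h_le: "varphi t x * varphi s y \<le> varphi t y * varphi s x"
    if "\<And>s. mono_on ?K (?h s)" "x \<in> ?K" "y \<in> ?K" "x \<le> y" "s \<le> t" for x y s t
    using log_deriv_le_imp_ratio_le[OF varphi varphi diff diff mono_onD[OF that(1)], of x y s t]
      that by simp
  \<comment> \<open>For a decreasing logarithmic derivative the ratio lemma is applied with the
    points \<open>x\<close> and \<open>y\<close> exchanged.\<close>
  have h_ge: "varphi t y * varphi s x \<le> varphi t x * varphi s y"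
    if "\<And>s. antimono_on ?K (?h s)" "x \<in> ?K" "y \<in> ?K" "x \<le> y" "s \<le> t" for x y s t
    using log_deriv_le_imp_ratio_le[OF varphi varphi diff diff monotone_onD[OF that(1)], of y x s t]
      that by simp
  have g_mono: "mono_on ?K ?g" if "\<forall>\<upsilon>\<in>ts_kappa ?K. 0 \<le> delta_deriv ?K ?g \<upsilon>"
    by (rule delta_deriv_nonneg_imp_mono_on[OF K]) (use assms(8) that in auto)
  have g_anti: "antimono_on ?K ?g" if "\<forall>\<upsilon>\<in>ts_kappa ?K. delta_deriv ?K ?g \<upsilon> \<le> 0"
    by (rule delta_deriv_nonpos_imp_antimono_on[OF K]) (use assms(8) that in auto)
  have h_mono: "mono_on ?K (?h s)" if "\<forall>s. \<forall>\<upsilon>\<in>ts_kappa ?K. 0 \<le> delta_deriv ?K (?h s) \<upsilon>" for s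
    by (rule delta_deriv_nonneg_imp_mono_on[OF K]) (use assms(9) that in auto)
  have h_anti: "antimono_on ?K (?h s)" if "\<forall>s. \<forall>\<upsilon>\<in>ts_kappa ?K. delta_deriv ?K (?h s) \<upsilon> \<le> 0" for s
    by (rule delta_deriv_nonpos_imp_antimono_on[OF K]) (use assms(9) that in auto)
  have "mono P"
    if "\<forall>\<upsilon>\<in>ts_kappa ?K. 0 \<le> delta_deriv ?K ?g \<upsilon>"
      "\<forall>s. \<forall>\<upsilon>\<in>ts_kappa ?K. 0 \<le> delta_deriv ?K (?h s) \<upsilon>"
    using g_le[OF g_mono[OF that(1)]]
      h_le[OF h_mono[OF that(2)]]
    by (intro monoI P_le mult_nonneg_nonneg) auto
  moreover have "mono P"
    if "\<forall>\<upsilon>\<in>ts_kappa ?K. delta_deriv ?K ?g \<upsilon> \<le> 0"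
      "\<forall>s. \<forall>\<upsilon>\<in>ts_kappa ?K. delta_deriv ?K (?h s) \<upsilon> \<le> 0"
    using g_ge[OF g_anti[OF that(1)]]
      h_ge[OF h_anti[OF that(2)]]
    by (intro monoI P_le mult_nonpos_nonpos) auto
  \<comment> \<open>For \<open>s \<le> t\<close> the criterion is now used with \<open>s\<close> and
    \<open>t\<close> exchanged. This reverses the sign of its second factor, so opposite
    monotonicities of \<psi>/\<phi> and the logarithmic derivative give a nonnegative
    product.\<close>
  moreover have "antimono P"
    if "\<forall>\<upsilon>\<in>ts_kappa ?K. 0 \<le> delta_deriv ?K ?g \<upsilon>"
      "\<forall>s. \<forall>\<upsilon>\<in>ts_kappa ?K. delta_deriv ?K (?h s) \<upsilon> \<le> 0"
    using g_le[OF g_mono[OF that(1)]]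
      h_ge[OF h_anti[OF that(2)]]
    by (intro antimonoI P_le mult_nonneg_nonneg) (auto simp: mult.commute)
  moreover have "antimono P"
    if "\<forall>\<upsilon>\<in>ts_kappa ?K. delta_deriv ?K ?g \<upsilon> \<le> 0"
      "\<forall>s. \<forall>\<upsilon>\<in>ts_kappa ?K. 0 \<le> delta_deriv ?K (?h s) \<upsilon>"
    using g_ge[OF g_anti[OF that(1)]]
      h_le[OF h_mono[OF that(2)]]
    by (intro antimonoI P_le mult_nonpos_nonpos) (auto simp: mult.commute)
  ultimately show ?thesis by blast
qed

end
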